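(* Let $H$ and $K$ be normal subgroups of a finite group $G$. Then \[d^\otimes(H,K)\le d^\wedge(H,K)\le d(H,K).\] Moreover, if $J(G,H,K)$ is trivial, then $d^\otimes(H,K)=d^\wedge(H,K)=d(H,K)$.
   Context: All groups are finite. For normal subgroups $H,K$ of a group $G$, all actions are by conjugation in $G$, written ${}^{x}y=xyx^{-1}$, and $[h,k]=hkh^{-1}k^{-1}$. The nonabelian tensor product $H\otimes K$ is the group generated by the symbols $h\otimes k$ ($h\in H$, $k\in K$) subject to the relations \[h_1h_2\otimes k_1=({}^{h_1}h_2\otimes {}^{h_1}k_1)(h_1\otimes k_1),\qquad h_1\otimes k_1k_2=(h_1\otimes k_1)({}^{k_1}h_1\otimes {}^{k_1}k_2)\] for all $h_1,h_2\in H$ and $k_1,k_2\in K$. There is an epimorphism $\kappa_{H,K}:H\otimes K\to[H,K]$ with $h\otimes k\mapsto[h,k]$, and $J(G,H,K)=\ker\kappa_{H,K}$, which is central in $H\otimes K$. Let $\nabla(H\cap K)=\langle x\otimes x : x\in H\cap K\rangle\le H\otimes K$ (it is contained in $J(G,H,K)$). The nonabelian exterior product is $H\wedge K=(H\otimes K)/\nabla(H\cap K)$, and for $h\in H$, $k\in K$ the element $h\wedge k$ is the coset $(h\otimes k)\nabla(H\cap K)$. The relative tensor degree, relative exterior degree and relative commutativity degree are \[d^\otimes(H,K)=\frac{|\{(h,k)\in H\times K : h\otimes k=1\}|}{|H||K|},\quad d^\wedge(H,K)=\frac{|\{(h,k)\in H\times K : h\wedge k=1\}|}{|H||K|},\]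 \[d(H,K)=\frac{|\{(h,k)\in H\times K : [h,k]=1\}|}{|H||K|}.\] *)

theory Defs
  imports Complex_Main "HOL-Algebra.Algebra"
begin

text \<open>
  Groups given by generators and relations.  A word over \<open>S\<close> is a list of signed letters:
  \<open>(True, s)\<close> stands for \<open>s\<close> and \<open>(False, s)\<close> for its inverse.  A pair \<open>(u, v) \<in> R\<close> is the
  relation \<open>u = v\<close>; elements of the presented group are classes of words over \<open>S\<close>.
\<close>

type_synonym 's word = "(bool \<times> 's) list"

definition words :: "'s set \<Rightarrow> 's word set" where
  "words S = lists (UNIV \<times> S)"

inductive pres_eq :: "'s set \<Rightarrow> ('s word \<times> 's word) set \<Rightarrow> 's word \<Rightarrow> 's word \<Rightarrow> bool"
  for S :: "'s set" and R :: "('s word \<times> 's word) set" where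
  pres_refl: "w \<in> words S \<Longrightarrow> pres_eq S R w w"
| pres_sym: "pres_eq S R u v \<Longrightarrow> pres_eq S R v u"
| pres_trans: "pres_eq S R u v \<Longrightarrow> pres_eq S R v w \<Longrightarrow> pres_eq S R u w"
| pres_append: "pres_eq S R u u' \<Longrightarrow> pres_eq S R v v' \<Longrightarrow> pres_eq S R (u @ v) (u' @ v')"
| pres_cancel: "s \<in> S \<Longrightarrow> pres_eq S R [(b, s), (\<not> b, s)] []"
| pres_rel: "(u, v) \<in> R \<Longrightarrow> u \<in> words S \<Longrightarrow> v \<in> words S \<Longrightarrow> pres_eq S R u v"

definition pres_class :: "'s set \<Rightarrow> ('s word \<times> 's word) set \<Rightarrow> 's word \<Rightarrow> 's word set" where
  "pres_class S R w = {v. pres_eq S R w v}"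

definition presented_group :: "'s set \<Rightarrow> ('s word \<times> 's word) set \<Rightarrow> 's word set monoid" where
  "presented_group S R =
     \<lparr>carrier = pres_class S R ` words S,
      monoid.mult = (\<lambda>A B. \<Union>u\<in>A. \<Union>v\<in>B. pres_class S R (u @ v)),
      monoid.one = pres_class S R []\<rparr>"

definition conjg :: "('a, 'b) monoid_scheme \<Rightarrow> 'a \<Rightarrow> 'a \<Rightarrow> 'a" where
  "conjg G x y = x \<otimes>\<^bsub>G\<^esub> y \<otimes>\<^bsub>G\<^esub> inv\<^bsub>G\<^esub> x"

definition commutator :: "('a, 'b) monoid_scheme \<Rightarrow> 'a \<Rightarrow> 'a \<Rightarrow> 'a" where
  "commutator G h k = h \<otimes>\<^bsub>G\<^esub> k \<otimes>\<^bsub>G\<^esub> inv\<^bsub>G\<^esub> h \<otimes>\<^bsub>G\<^esub> inv\<^bsub>G\<^esub> k"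

definition commutator_subgroup :: "('a, 'b) monoid_scheme \<Rightarrow> 'a set \<Rightarrow> 'a set \<Rightarrow> 'a set" where
  "commutator_subgroup G H K = generate G {commutator G h k | h k. h \<in> H \<and> k \<in> K}"

definition tensor_rels ::
  "('a, 'b) monoid_scheme \<Rightarrow> 'a set \<Rightarrow> 'a set \<Rightarrow> (('a \<times> 'a) word \<times> ('a \<times> 'a) word) set" where
  "tensor_rels G H K =
     {([(True, (h1 \<otimes>\<^bsub>G\<^esub> h2, k1))],
       [(True, (conjg G h1 h2, conjg G h1 k1)), (True, (h1, k1))])
      | h1 h2 k1. h1 \<in> H \<and> h2 \<in> H \<and> k1 \<in> K} \<union>
     {([(True, (h1, k1 \<otimes>\<^bsub>G\<^esub> k2))],
       [(True, (h1, k1)), (True, (conjg G k1 h1, conjg G k1 k2))])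
      | h1 k1 k2. h1 \<in> H \<and> k1 \<in> K \<and> k2 \<in> K}"

definition tensor_product ::
  "('a, 'b) monoid_scheme \<Rightarrow> 'a set \<Rightarrow> 'a set \<Rightarrow> ('a \<times> 'a) word set monoid" where
  "tensor_product G H K = presented_group (H \<times> K) (tensor_rels G H K)"

definition tensor ::
  "('a, 'b) monoid_scheme \<Rightarrow> 'a set \<Rightarrow> 'a set \<Rightarrow> 'a \<Rightarrow> 'a \<Rightarrow> ('a \<times> 'a) word set" where
  "tensor G H K h k = pres_class (H \<times> K) (tensor_rels G H K) [(True, (h, k))]"

fun eval_word :: "('a, 'b) monoid_scheme \<Rightarrow> ('s \<Rightarrow> 'a) \<Rightarrow> 's word \<Rightarrow> 'a" where
  "eval_word G f [] = \<one>\<^bsub>G\<^esub>"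
| "eval_word G f ((b, s) # w) = (if b then f s else inv\<^bsub>G\<^esub> (f s)) \<otimes>\<^bsub>G\<^esub> eval_word G f w"

text \<open>
  For normal subgroups \<open>H\<close>, \<open>K\<close> the value of a word under \<open>(h, k) \<mapsto> [h, k]\<close> depends only on its
  class, so the image of the class is a singleton and \<open>kappa\<close> is the homomorphism
  sending \<open>h \<otimes> k\<close> to \<open>[h, k]\<close>.
\<close>

definition kappa ::
  "('a, 'b) monoid_scheme \<Rightarrow> ('a \<times> 'a) word set \<Rightarrow> 'a" where
  "kappa G A = the_elem (eval_word G (\<lambda>(h, k). commutator G h k) ` A)"

definition J_kernel ::
  "('a, 'b) monoid_scheme \<Rightarrow> 'a set \<Rightarrow> 'a set \<Rightarrow> ('a \<times> 'a) word set set" where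
  "J_kernel G H K =
     kernel (tensor_product G H K) (G\<lparr>carrier := commutator_subgroup G H K\<rparr>) (kappa G)"

definition nabla ::
  "('a, 'b) monoid_scheme \<Rightarrow> 'a set \<Rightarrow> 'a set \<Rightarrow> ('a \<times> 'a) word set set" where
  "nabla G H K = generate (tensor_product G H K) {tensor G H K x x | x. x \<in> H \<inter> K}"

definition exterior_product ::
  "('a, 'b) monoid_scheme \<Rightarrow> 'a set \<Rightarrow> 'a set \<Rightarrow> ('a \<times> 'a) word set set monoid" where
  "exterior_product G H K = tensor_product G H K Mod nabla G H K"

text \<open>
  The subgroup \<open>nabla G H K\<close> is central, so the library's right cosets agree with the left ones.
\<close>

definition wedge ::
  "('a, 'b) monoid_scheme \<Rightarrow> 'a set \<Rightarrow> 'a set \<Rightarrow> 'a \<Rightarrow> 'a \<Rightarrow> ('a \<times> 'a) word set set" where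
  "wedge G H K h k = nabla G H K #>\<^bsub>tensor_product G H K\<^esub> tensor G H K h k"

definition tensor_degree :: "('a, 'b) monoid_scheme \<Rightarrow> 'a set \<Rightarrow> 'a set \<Rightarrow> real" where
  "tensor_degree G H K =
     real (card {(h, k) \<in> H \<times> K. tensor G H K h k = \<one>\<^bsub>tensor_product G H K\<^esub>})
       / (real (card H) * real (card K))"

definition exterior_degree :: "('a, 'b) monoid_scheme \<Rightarrow> 'a set \<Rightarrow> 'a set \<Rightarrow> real" where
  "exterior_degree G H K =
     real (card {(h, k) \<in> H \<times> K. wedge G H K h k = \<one>\<^bsub>exterior_product G H K\<^esub>})
       / (real (card H) * real (card K))"

definition commutativity_degree :: "('a, 'b) monoid_scheme \<Rightarrow> 'a set \<Rightarrow> 'a set \<Rightarrow> real" where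
  "commutativity_degree G H K =
     real (card {(h, k) \<in> H \<times> K. commutator G h k = \<one>\<^bsub>G\<^esub>})
       / (real (card H) * real (card K))"

end

theory Submission
  imports Defs
begin

text \<open>
  The three sets of pairs being counted are the pairs with \<open>h \<otimes> k = 1\<close>, those with
  \<open>h \<otimes> k \<in> \<nabla>\<close>, and those with \<open>h \<otimes> k \<in> J\<close>.  Since \<open>1 \<in> \<nabla> \<subseteq> J\<close>, they increase, and they
  coincide when \<open>J\<close> is trivial.  The main point is that \<open>[h, k]\<close> respects the tensor relations,
  so that \<open>\<kappa>\<close> is a homomorphism on the presented group.
\<close>

section \<open>Words and presented groups\<close>

lemma words_Nil [simp]: "[] \<in> words S"
  and words_Cons [simp]: "p # w \<in> words S \<longleftrightarrow> snd p \<in> S \<and> w \<in> words S"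
  and words_append [simp]: "u @ v \<in> words S \<longleftrightarrow> u \<in> words S \<and> v \<in> words S"
  by (cases p; auto simp: words_def)+

lemma pres_eq_words: "pres_eq S R u v \<Longrightarrow> u \<in> words S \<and> v \<in> words S"
  by (induction rule: pres_eq.induct) auto

text \<open>\<open>pres_eq\<close> is an equivalence relation on words. Reflexivity puts
  \<open>u\<close> into its own class, so equal classes relate \<open>v\<close> to \<open>u\<close>,
  which also forces \<open>v\<close> to be a word.\<close>

lemma pres_class_eq_iff:
  assumes "u \<in> words S"
  shows "pres_class S R u = pres_class S R v \<longleftrightarrow> pres_eq S R u v"
  using assms unfolding pres_class_def
  by (blast intro: pres_refl pres_sym pres_trans)

text \<open>The product is a union over all pairs of representatives. Since \<open>pres_eq\<close>
  is a congruence, all sets in this union are equal, and since each class contains its own word, the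
  union is not empty.\<close>

lemma pres_class_mult:
  assumes "u \<in> words S" "v \<in> words S"
  shows "pres_class S R u \<otimes>\<^bsub>presented_group S R\<^esub> pres_class S R v = pres_class S R (u @ v)"
proof -
  have "pres_class S R (u' @ v') = pres_class S R (u @ v)"
    if "u' \<in> pres_class S R u" "v' \<in> pres_class S R v" for u' v'
  proof -
    have "pres_eq S R (u @ v) (u' @ v')"
      using that by (simp add: pres_class_def pres_append)
    then show ?thesis
      using assms by (simp add: pres_class_eq_iff[symmetric])
  qed
  moreover have "u \<in> pres_class S R u" "v \<in> pres_class S R v"
    using assms by (simp_all add: pres_class_def pres_refl)
  ultimately have "(\<Union>u'\<in>pres_class S R u. \<Union>v'\<in>pres_class S R v. pres_class S R (u' @ v'))
      = pres_class S R (u @ v)"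
    by blast
  then show ?thesis
    by (simp add: presented_group_def)
qed

lemma carrier_presented_group: "carrier (presented_group S R) = pres_class S R ` words S"
  by (simp add: presented_group_def)

lemma one_presented_group: "\<one>\<^bsub>presented_group S R\<^esub> = pres_class S R []"
  by (simp add: presented_group_def)

text \<open>The witness is the reversed word with all signs flipped, built by appending the flipped
  first letter to a left inverse of the tail.\<close>

lemma pres_eq_left_inverse:
  assumes "w \<in> words S"
  shows "\<exists>v\<in>words S. pres_eq S R (v @ w) []"
  using assms
proof (induction w)
  case Nil
  then show ?case by (auto intro!: bexI[of _ "[]"] pres_refl)
next
  case (Cons p w)
  obtain b s where p: "p = (b, s)" by force
  from Cons obtain v where v: "v \<in> words S" "pres_eq S R (v @ w) []" and w: "w \<in> words S" and s: "s \<in> S"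
    by (auto simp: p)
  \<comment> \<open>The double negation makes the pair an instance of \<open>pres_cancel\<close>
    with sign \<open>\<not> b\<close>.\<close>
  have "pres_eq S R (v @ [(\<not> b, s), (\<not> \<not> b, s)] @ w) (v @ [] @ w)"
    by (intro pres_append pres_cancel pres_refl v w s)
  then have "pres_eq S R ((v @ [(\<not> b, s)]) @ p # w) []"
    using v(2) by (simp add: p) (rule pres_trans)
  with v s show ?case by (intro bexI[of _ "v @ [(\<not> b, s)]"]) auto
qed

lemma group_presented_group: "group (presented_group S R)"
proof (rule groupI)
  fix x assume "x \<in> carrier (presented_group S R)"
  then obtain w where w: "w \<in> words S" "x = pres_class S R w"
    by (auto simp: carrier_presented_group)
  with pres_eq_left_inverse obtain v where "v \<in> words S" "pres_eq S R (v @ w) []"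
    by blast
  with w show "\<exists>y\<in>carrier (presented_group S R). y \<otimes>\<^bsub>presented_group S R\<^esub> x = \<one>\<^bsub>presented_group S R\<^esub>"
    by (intro bexI[of _ "pres_class S R v"])
      (auto simp: carrier_presented_group one_presented_group pres_class_mult pres_class_eq_iff)
qed (auto simp: carrier_presented_group one_presented_group pres_class_mult)

section \<open>Von Dyck's theorem and the commutator map\<close>

context group
begin

lemma eval_word_closed:
  "f \<in> S \<rightarrow> carrier G \<Longrightarrow> w \<in> words S \<Longrightarrow> eval_word G f w \<in> carrier G"
  by (induction w) (auto simp: Pi_iff)

lemma eval_word_append:
  "f \<in> S \<rightarrow> carrier G \<Longrightarrow> u \<in> words S \<Longrightarrow> v \<in> words S \<Longrightarrow>
    eval_word G f (u @ v) = eval_word G f u \<otimes> eval_word G f v"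
proof (induction u)
  case (Cons p u)
  obtain b s where p: "p = (b, s)" by force
  have "f s \<in> carrier G" "eval_word G f u \<in> carrier G" "eval_word G f v \<in> carrier G"
    using Cons.prems eval_word_closed[OF Cons.prems(1)] by (auto simp: p)
  with Cons show ?case by (auto simp: p m_assoc)
qed (simp add: eval_word_closed)

text \<open>Evaluation turns concatenation into multiplication and kills cancelling pairs, so
  agreement on the relations spreads to the whole congruence they generate.\<close>

lemma eval_word_pres_eq:
  assumes "f \<in> S \<rightarrow> carrier G"
    and rels: "\<And>u v. (u, v) \<in> R \<Longrightarrow> u \<in> words S \<Longrightarrow> v \<in> words S \<Longrightarrow> eval_word G f u = eval_word G f v"
    and "pres_eq S R u v"
  shows "eval_word G f u = eval_word G f v"
  using assms(3)
proof (induction rule: pres_eq.induct)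
  case (pres_append u u' v v')
  from pres_append(1,2)[THEN pres_eq_words] pres_append(3,4) show ?case
    by (simp add: eval_word_append[OF assms(1)])
next
  case (pres_cancel s b)
  then have "f s \<in> carrier G" using assms(1) by auto
  then show ?case by auto
qed (auto simp: rels)

lemma eval_word_pres_class:
  assumes "f \<in> S \<rightarrow> carrier G"
    and "\<And>u v. (u, v) \<in> R \<Longrightarrow> u \<in> words S \<Longrightarrow> v \<in> words S \<Longrightarrow> eval_word G f u = eval_word G f v"
    and "w \<in> words S"
  shows "the_elem (eval_word G f ` pres_class S R w) = eval_word G f w"
proof -
  have "w \<in> pres_class S R w" using assms(3) by (simp add: pres_class_def pres_refl)
  moreover have "eval_word G f v = eval_word G f w" if "v \<in> pres_class S R w" for v
    using eval_word_pres_eq[OF assms(1,2), of R w v] that by (simp add: pres_class_def)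
  ultimately have "eval_word G f ` pres_class S R w = {eval_word G f w}" by blast
  then show ?thesis by simp
qed

text \<open>Von Dyck's theorem: each class evaluates to a singleton, so \<open>the_elem\<close>
  returns the value of any representative.\<close>

lemma presented_group_hom:
  assumes "f \<in> S \<rightarrow> carrier G"
    and "\<And>u v. (u, v) \<in> R \<Longrightarrow> u \<in> words S \<Longrightarrow> v \<in> words S \<Longrightarrow> eval_word G f u = eval_word G f v"
  shows "(\<lambda>A. the_elem (eval_word G f ` A)) \<in> hom (presented_group S R) G"
  by (rule homI)
    (auto simp: carrier_presented_group pres_class_mult eval_word_pres_class[OF assms]
      eval_word_append[OF assms(1)] eval_word_closed[OF assms(1)])

text \<open>Once \<open>m_assoc\<close> has moved all brackets to the right, \<open>x\<close> and
  \<open>inv x\<close> meet only in this shape; with these rules \<open>simp\<close> decides the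
  commutator identities.\<close>

lemma inv_mult_cancel_left:
  assumes "x \<in> carrier G" "y \<in> carrier G"
  shows "inv x \<otimes> (x \<otimes> y) = y" "x \<otimes> (inv x \<otimes> y) = y"
  using assms by (simp_all flip: m_assoc)

text \<open>The first factor on the right is the conjugate of \<open>commutator G y z\<close> by
  \<open>x\<close>. This identity is the image of the first family of tensor relations;
  \<open>commutator_mult_right\<close> serves the second.\<close>

lemma commutator_mult_left:
  assumes "x \<in> carrier G" "y \<in> carrier G" "z \<in> carrier G"
  shows "commutator G (x \<otimes> y) z
    = commutator G (conjg G x y) (conjg G x z) \<otimes> commutator G x z"
  using assms
  by (simp add: commutator_def conjg_def m_assoc inv_mult_group inv_mult_cancel_left)

lemma commutator_mult_right:
  assumes "x \<in> carrier G" "y \<in> carrier G" "z \<in> carrier G"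
  shows "commutator G x (y \<otimes> z)
    = commutator G x y \<otimes> commutator G (conjg G y x) (conjg G y z)"
  using assms
  by (simp add: commutator_def conjg_def m_assoc inv_mult_group inv_mult_cancel_left)

lemma commutator_closed:
  "x \<in> carrier G \<Longrightarrow> y \<in> carrier G \<Longrightarrow> commutator G x y \<in> carrier G"
  by (simp add: commutator_def)

lemma conjg_closed:
  "x \<in> carrier G \<Longrightarrow> y \<in> carrier G \<Longrightarrow> conjg G x y \<in> carrier G"
  by (simp add: conjg_def)

lemma commutator_tensor_rels:
  assumes "H \<subseteq> carrier G" "K \<subseteq> carrier G" "(u, v) \<in> tensor_rels G H K"
  shows "eval_word G (\<lambda>(h, k). commutator G h k) u = eval_word G (\<lambda>(h, k). commutator G h k) v"
proof -
  have H: "h \<in> carrier G" if "h \<in> H" for h using that assms(1) by blast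
  have K: "k \<in> carrier G" if "k \<in> K" for k using that assms(2) by blast
  from assms(3) consider
      (left) h1 h2 k where "h1 \<in> H" "h2 \<in> H" "k \<in> K" "u = [(True, (h1 \<otimes> h2, k))]"
        "v = [(True, (conjg G h1 h2, conjg G h1 k)), (True, (h1, k))]"
    | (right) h k1 k2 where "h \<in> H" "k1 \<in> K" "k2 \<in> K" "u = [(True, (h, k1 \<otimes> k2))]"
        "v = [(True, (h, k1)), (True, (conjg G k1 h, conjg G k1 k2))]"
    unfolding tensor_rels_def by blast
  then show ?thesis
    by cases (simp_all add: H K commutator_mult_left commutator_mult_right commutator_closed conjg_closed)
qed

lemma commutator_Pi:
  "H \<subseteq> carrier G \<Longrightarrow> K \<subseteq> carrier G \<Longrightarrow> (\<lambda>(h, k). commutator G h k) \<in> H \<times> K \<rightarrow> carrier G"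
  by (auto intro: commutator_closed)

text \<open>Here \<open>kappa\<close> is taken with codomain all of \<open>G\<close>; its kernel is
  still \<open>J_kernel\<close>, as a kernel depends on the codomain only through the unit.\<close>

lemma kappa_hom:
  assumes "H \<subseteq> carrier G" "K \<subseteq> carrier G"
  shows "kappa G \<in> hom (tensor_product G H K) G"
  unfolding tensor_product_def kappa_def[abs_def]
  by (rule presented_group_hom[OF commutator_Pi[OF assms] commutator_tensor_rels[OF assms]])

lemma kappa_tensor:
  assumes "H \<subseteq> carrier G" "K \<subseteq> carrier G" "h \<in> H" "k \<in> K"
  shows "kappa G (tensor G H K h k) = commutator G h k"
proof -
  have "commutator G h k \<in> carrier G" using assms by (auto intro: commutator_closed)
  then show ?thesis
    using assms unfolding kappa_def tensor_def
    by (subst eval_word_pres_class[OF commutator_Pi[OF assms(1,2)] commutator_tensor_rels[OF assms(1,2)]])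
      auto
qed

end

section \<open>The subgroup \<open>nabla\<close> and the three degrees\<close>

lemma tensor_closed:
  "h \<in> H \<Longrightarrow> k \<in> K \<Longrightarrow> tensor G H K h k \<in> carrier (tensor_product G H K)"
  by (simp add: tensor_def tensor_product_def carrier_presented_group)

lemma group_tensor_product: "group (tensor_product G H K)"
  by (simp add: tensor_product_def group_presented_group)

lemma subgroup_nabla: "subgroup (nabla G H K) (tensor_product G H K)"
  unfolding nabla_def
  by (rule group.generate_is_subgroup[OF group_tensor_product]) (auto intro: tensor_closed)

text \<open>Each generator goes to \<open>commutator G x x\<close>, which is trivial, and the kernel
  is a subgroup.\<close>

lemma (in group) nabla_subset_kernel:
  assumes "H \<subseteq> carrier G" "K \<subseteq> carrier G"
  shows "nabla G H K \<subseteq> kernel (tensor_product G H K) G (kappa G)"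
proof -
  interpret kappa: group_hom "tensor_product G H K" G "kappa G"
    by (intro group_hom.intro group_hom_axioms.intro group_tensor_product group_axioms kappa_hom assms)
  have "tensor G H K x x \<in> kernel (tensor_product G H K) G (kappa G)" if "x \<in> H \<inter> K" for x
  proof -
    from that assms have x: "x \<in> H" "x \<in> K" "x \<in> carrier G" by blast+
    then have "commutator G x x = \<one>"
      by (simp add: commutator_def m_assoc inv_mult_cancel_left)
    then show ?thesis
      using x by (simp add: kernel_def tensor_closed kappa_tensor[OF assms])
  qed
  then have "{tensor G H K x x |x. x \<in> H \<inter> K} \<subseteq> kernel (tensor_product G H K) G (kappa G)"
    by blast
  then show ?thesis
    unfolding nabla_def by (rule kappa.G.generate_subgroup_incl[OF _ kappa.subgroup_kernel])
qed

text \<open>The unit of the quotient is \<open>nabla\<close> itself, and a coset of a subgroup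
  equals the subgroup exactly when its representative lies in it.\<close>

lemma wedge_eq_one_iff:
  assumes "h \<in> H" "k \<in> K"
  shows "wedge G H K h k = \<one>\<^bsub>exterior_product G H K\<^esub> \<longleftrightarrow> tensor G H K h k \<in> nabla G H K"
proof -
  interpret T: group "tensor_product G H K"
    by (rule group_tensor_product)
  have "wedge G H K h k = nabla G H K \<longleftrightarrow> tensor G H K h k \<in> nabla G H K"
    unfolding wedge_def
    by (rule iffI, rule T.coset_join1[OF _ tensor_closed[OF assms] subgroup_nabla],
        assumption, rule T.coset_join2[OF tensor_closed[OF assms] subgroup_nabla])
  then show ?thesis
    by (simp add: exterior_product_def FactGroup_def)
qed

theorem theorem1p2:
  fixes G :: "('a, 'b) monoid_scheme" and H K :: "'a set"
  assumes "group G" and "finite (carrier G)"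
    and "H \<lhd> G" and "K \<lhd> G"
  shows "tensor_degree G H K \<le> exterior_degree G H K
       \<and> exterior_degree G H K \<le> commutativity_degree G H K
       \<and> (J_kernel G H K = {\<one>\<^bsub>tensor_product G H K\<^esub>} \<longrightarrow>
            tensor_degree G H K = exterior_degree G H K
          \<and> exterior_degree G H K = commutativity_degree G H K)"
proof -
  interpret group G by fact
  have sub: "H \<subseteq> carrier G" "K \<subseteq> carrier G"
    using assms(3,4)[THEN normal_imp_subgroup] by (auto dest: subgroup.subset)
  let ?T = "{(h, k) \<in> H \<times> K. tensor G H K h k = \<one>\<^bsub>tensor_product G H K\<^esub>}"
  let ?E = "{(h, k) \<in> H \<times> K. wedge G H K h k = \<one>\<^bsub>exterior_product G H K\<^esub>}"
  let ?C = "{(h, k) \<in> H \<times> K. commutator G h k = \<one>\<^bsub>G\<^esub>}"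
  have TE: "?T \<subseteq> ?E"
    by (simp add: subset_iff wedge_eq_one_iff subgroup.one_closed[OF subgroup_nabla])
  have "commutator G h k = \<one>\<^bsub>G\<^esub>" if "tensor G H K h k \<in> nabla G H K" "h \<in> H" "k \<in> K" for h k
    using subsetD[OF nabla_subset_kernel[OF sub] that(1)] that(2,3)
    by (simp add: kernel_def kappa_tensor[OF sub])
  then have EC: "?E \<subseteq> ?C"
    \<comment> \<open>\<open>conj_cong\<close> makes the memberships in \<open>H\<close> and
      \<open>K\<close> available as side conditions of \<open>wedge_eq_one_iff\<close>.\<close>
    by (simp add: subset_iff wedge_eq_one_iff cong: conj_cong)
  have CT: "?C \<subseteq> ?T" if J: "J_kernel G H K = {\<one>\<^bsub>tensor_product G H K\<^esub>}"
  proof -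
    have "tensor G H K h k \<in> J_kernel G H K"
      if "h \<in> H" "k \<in> K" "commutator G h k = \<one>\<^bsub>G\<^esub>" for h k
      using that by (simp add: J_kernel_def kernel_def kappa_tensor[OF sub] tensor_closed)
    then show ?thesis
      by (simp add: J subset_iff)
  qed
  \<comment> \<open>Finiteness is what \<open>card_mono\<close> asks of the larger set.\<close>
  have "finite H" "finite K"
    using sub assms(2) by (blast intro: finite_subset)+
  then have "finite (H \<times> K)"
    by simp
  then have fin: "finite ?E" "finite ?C"
    by (rule finite_subset[rotated], blast)+
  have "real (card ?T) \<le> real (card ?E)" "real (card ?E) \<le> real (card ?C)"
    by (intro of_nat_mono card_mono fin TE EC)+
  then have le: "tensor_degree G H K \<le> exterior_degree G H K"
      "exterior_degree G H K \<le> commutativity_degree G H K"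
    unfolding tensor_degree_def exterior_degree_def commutativity_degree_def
    by (simp_all only: divide_right_mono mult_nonneg_nonneg of_nat_0_le_iff)
  \<comment> \<open>This closes the chain of inequalities into a cycle, so both equalities follow by
    antisymmetry.\<close>
  have "commutativity_degree G H K \<le> tensor_degree G H K"
    if "J_kernel G H K = {\<one>\<^bsub>tensor_product G H K\<^esub>}"
  proof -
    have "finite ?T"
      by (rule finite_subset[OF TE fin(1)])
    then have "real (card ?C) \<le> real (card ?T)"
      by (intro of_nat_mono card_mono CT that)
    then show ?thesis
      unfolding tensor_degree_def commutativity_degree_def
      by (simp only: divide_right_mono mult_nonneg_nonneg of_nat_0_le_iff)
  qed
  with le show ?thesis
    by force
qed

end
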